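(* Let $T$ be a rational pinwheel tiling. The minimal number of colours in a proper face colouring of $T$ is $3$.
   Context: Rational pinwheel substitution. The prototile $K$ is the right triangle with side lengths $1,2,\sqrt5$. The substitution $\omega$ expands a tile by $\sqrt5$ and dissects it into five tiles: the expanded tile, placed as the triangle with vertices $(0,0)$ (right angle), $(2,-1)$, $(2,4)$, is dissected into the triangles with vertices $\{(2,-1),(2,0),(0,0)\}$, $\{(0,0),(1,0),(1,2)\}$, $\{(1,0),(2,0),(2,2)\}$, $\{(1,0),(1,2),(2,2)\}$, $\{(1,2),(2,2),(2,4)\}$. The rule is extended to all congruent copies of $K$ (including reflections) and to collections of tiles covariantly. A rational pinwheel tiling is a tiling $T$ of $\mathbb{R}^2$ by congruent copies of $K$ such that every finite set of tiles of $T$ is contained in a congruent copy of $\omega^n(K)$ for some $n\ge0$. A proper face colouring is an assignment of colours to the tiles such that any two distinct tiles whose boundaries share a segment of positive length have different colours. *)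

theory Defs
  imports "HOL-Analysis.Analysis"
begin

text \<open>The plane is \<open>real \<times> real\<close>, whose library metric is the Euclidean one. Tiles are closed
  triangles, represented as point sets.\<close>

type_synonym plane = "real \<times> real"

text \<open>Orientation-reversing maps are included; bijectivity is automatic in finite dimension.\<close>

definition plane_isometry :: "(plane \<Rightarrow> plane) \<Rightarrow> bool" where
  "plane_isometry g \<longleftrightarrow> (\<forall>x y. dist (g x) (g y) = dist x y)"

definition prototile :: "plane set" where
  "prototile = convex hull {(0, 0), (2, 0), (0, 1)}"

definition is_tile :: "plane set \<Rightarrow> bool" where
  "is_tile t \<longleftrightarrow> (\<exists>g. plane_isometry g \<and> t = g ` prototile)"

text \<open>A congruent copy of \<open>sqrt 5\<close> times the prototile, with right angle at the origin.\<close>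

definition expanded_tile :: "plane set" where
  "expanded_tile = convex hull {(0, 0), (2, -1), (2, 4)}"

definition expanded_tile_dissection :: "plane set set" where
  "expanded_tile_dissection =
    {convex hull {(2, -1), (2, 0), (0, 0)},
     convex hull {(0, 0), (1, 0), (1, 2)},
     convex hull {(1, 0), (2, 0), (2, 2)},
     convex hull {(1, 0), (1, 2), (2, 2)},
     convex hull {(1, 2), (2, 2), (2, 4)}}"

text \<open>The isometry \<open>g\<close> carrying \<open>expanded_tile\<close> onto the expansion of the tile \<open>t\<close> is unique,
  because the triangle is scalene; so the set below consists of exactly five tiles.\<close>

definition pinwheel_subst_tile :: "plane set \<Rightarrow> plane set set" where
  "pinwheel_subst_tile t =
    {g ` s | g s. plane_isometry g \<and> g ` expanded_tile = (*\<^sub>R) (sqrt 5) ` t \<and>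
                  s \<in> expanded_tile_dissection}"

definition pinwheel_subst :: "plane set set \<Rightarrow> plane set set" where
  "pinwheel_subst P = (\<Union>t\<in>P. pinwheel_subst_tile t)"

definition supertile :: "nat \<Rightarrow> plane set set" where
  "supertile n = (pinwheel_subst ^^ n) {prototile}"

definition is_tiling :: "plane set set \<Rightarrow> bool" where
  "is_tiling T \<longleftrightarrow>
    (\<forall>t\<in>T. is_tile t) \<and>
    \<Union>T = UNIV \<and>
    pairwise (\<lambda>s t. interior s \<inter> interior t = {}) T"

definition rational_pinwheel_tiling :: "plane set set \<Rightarrow> bool" where
  "rational_pinwheel_tiling T \<longleftrightarrow>
    is_tiling T \<and>
    (\<forall>F. finite F \<and> F \<subseteq> T \<longrightarrow>
      (\<exists>n g. plane_isometry g \<and> F \<subseteq> (\<lambda>t. g ` t) ` supertile n))"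

definition share_segment :: "plane set \<Rightarrow> plane set \<Rightarrow> bool" where
  "share_segment s t \<longleftrightarrow>
    (\<exists>a b. a \<noteq> b \<and> closed_segment a b \<subseteq> frontier s \<inter> frontier t)"

definition proper_face_colouring :: "plane set set \<Rightarrow> (plane set \<Rightarrow> 'c) \<Rightarrow> bool" where
  "proper_face_colouring T c \<longleftrightarrow>
    (\<forall>s\<in>T. \<forall>t\<in>T. s \<noteq> t \<and> share_segment s t \<longrightarrow> c s \<noteq> c t)"

definition face_colourable :: "plane set set \<Rightarrow> nat \<Rightarrow> bool" where
  "face_colourable T k \<longleftrightarrow>
    (\<exists>c :: plane set \<Rightarrow> nat. c ` T \<subseteq> {..<k} \<and> proper_face_colouring T c)"

text \<open>Stated as a relation, since \<open>LEAST\<close> would be unspecified if no finite colouring existed.\<close>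

definition min_face_colours :: "plane set set \<Rightarrow> nat \<Rightarrow> bool" where
  "min_face_colours T k \<longleftrightarrow>
    face_colourable T k \<and> (\<forall>m. face_colourable T m \<longrightarrow> k \<le> m)"

end

(*
  Conjugating the substitution by the map expand, which is sqrt 5 times a reflection and has square
  5, puts all tiles of a supertile into integer poses: translations by Gaussian integers composed
  with quarter turns.  Two non-overlapping tiles in such poses share a segment only if their
  relative pose is one of nine.  Adjacent tiles have equal or adjacent parents, so a colouring
  which reads off the child number and the direction of a tile is checked by a finite table;
  compactness carries it over to the whole tiling.  Conversely the second-level supertile contains
  three mutually adjacent tiles.  A tiling lies on a single integer grid, hence is locally finite,
  and so every tiling contains a second-level supertile.
*)
theory Submission
  imports Defs
begin

section \<open>Isometries of the plane\<close>

text \<open>The substitution scales without turning, while the dissection is drawn on an expanded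
  triangle that is turned and reflected. One isometry per level absorbs this mismatch. All five
  pieces have the same handedness, opposite to that of the expanded triangle, so inside a supertile
  only rotations occur and the reflection stays in \<open>expand\<close>. The colour of a tile
  refers to its parent, but a tiling comes without parents: its finite subsets are placed in
  supertiles, and nothing in the definition makes these placements agree. Parents are unique inside
  one patch, hence the detour through finite sets and compactness. For the lower bound, too, the
  definition puts tiles of the tiling into supertiles and not conversely. To get a whole supertile
  into the tiling one needs a finite set of tiles that covers a large ball, hence local finiteness.
  Level two is the first that works: adjacency in the first-level supertile is a 4-cycle with one
  pendant tile, which is bipartite.\<close>

lemma plane_isometry_affine:
  assumes "plane_isometry g"
  obtains v h where "orthogonal_transformation h" "g = (\<lambda>x. v + h x)"
proof -
  define h where "h x = g x - g 0" for x
  have "orthogonal_transformation h"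
    using assms orthogonal_transformation_isometry[of h]
    by (auto simp: plane_isometry_def h_def dist_norm)
  moreover have "g = (\<lambda>x. g 0 + h x)"
    by (simp add: h_def)
  ultimately show thesis by (rule that)
qed

lemma plane_isometry_comp:
  "plane_isometry g \<Longrightarrow> plane_isometry h \<Longrightarrow> plane_isometry (g \<circ> h)"
  by (simp add: plane_isometry_def del: split_paired_All)

lemma plane_isometry_bij:
  assumes "plane_isometry g"
  shows "bij g"
proof -
  obtain v h where h: "orthogonal_transformation h" "g = (\<lambda>x. v + h x)"
    using plane_isometry_affine[OF assms] by blast
  have "g = (+) v \<circ> h" by (auto simp: h(2))
  moreover have "bij h" using h(1) by (rule orthogonal_transformation_bij)
  moreover have "bij ((+) v)"
    by (rule bij_plus)
  ultimately show ?thesis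
    by (metis bij_comp)
qed

lemma plane_isometry_inv:
  assumes "plane_isometry g"
  shows "plane_isometry (inv g)"
  unfolding plane_isometry_def
proof (intro allI)
  fix x y
  have "g (inv g z) = z" for z
    using plane_isometry_bij[OF assms] by (simp add: bij_is_surj surj_f_inv_f)
  then show "dist (inv g x) (inv g y) = dist x y"
    using assms unfolding plane_isometry_def by metis
qed

lemma plane_isometry_interior_image:
  assumes "plane_isometry g"
  shows "interior (g ` S) = g ` interior S"
proof -
  obtain v h where h: "orthogonal_transformation h" "g = (\<lambda>x. v + h x)"
    using plane_isometry_affine[OF assms] by blast
  have img: "g ` X = (+) v ` (h ` X)" for X by (auto simp: h(2))
  show ?thesis
    using h(1) by (simp add: img interior_translation interior_injective_linear_image
        orthogonal_transformation_linear orthogonal_transformation_inj)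
qed

lemma plane_isometry_convex_hull:
  assumes "plane_isometry g"
  shows "g ` (convex hull S) = convex hull (g ` S)"
proof -
  obtain v h where h: "orthogonal_transformation h" "g = (\<lambda>x. v + h x)"
    using plane_isometry_affine[OF assms] by blast
  have img: "g ` X = (+) v ` (h ` X)" for X by (auto simp: h(2))
  show ?thesis
    using h(1) by (simp add: img convex_hull_translation convex_hull_linear_image
        orthogonal_transformation_linear)
qed

lemma plane_isometry_fixing_triangle:
  assumes g: "plane_isometry g" and fixd: "g (0, 0) = (0, 0)" "g (2, 0) = (2, 0)" "g (0, 1) = (0, 1)"
  shows "g = id"
proof
  fix z :: plane
  obtain v h where h: "orthogonal_transformation h" "g = (\<lambda>x. v + h x)"
    using plane_isometry_affine[OF g] by blast
  interpret linear h using h(1) by (rule orthogonal_transformation_linear)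
  have "v = 0" using fixd(1) zero by (simp add: h(2) zero_prod_def)
  then have gh: "g x = h x" for x by (simp add: h(2))
  have "z = (fst z / 2) *\<^sub>R (2, 0) + snd z *\<^sub>R (0, 1)" by (cases z) simp
  then have "h z = h ((fst z / 2) *\<^sub>R (2, 0) + snd z *\<^sub>R (0, 1))"
    by (rule arg_cong)
  also have "\<dots> = (fst z / 2) *\<^sub>R h (2, 0) + snd z *\<^sub>R h (0, 1)"
    unfolding add scale ..
  finally have "h z = (fst z / 2) *\<^sub>R h (2, 0) + snd z *\<^sub>R h (0, 1)" .
  then show "g z = id z" using fixd gh by (cases z) simp
qed

section \<open>The prototile\<close>

lemma prototile_eq: "prototile = {(x, y). 0 \<le> x \<and> 0 \<le> y \<and> x + 2 * y \<le> 2}"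
proof (intro set_eqI iffI)
  fix z assume "z \<in> prototile"
  then show "z \<in> {(x, y). 0 \<le> x \<and> 0 \<le> y \<and> x + 2 * y \<le> 2}"
    unfolding prototile_def convex_hull_3 by auto
next
  fix z :: plane assume "z \<in> {(x, y). 0 \<le> x \<and> 0 \<le> y \<and> x + 2 * y \<le> 2}"
  then obtain x y where "z = (x, y)" "0 \<le> x" "0 \<le> y" "x + 2 * y \<le> 2" by auto
  then have "\<exists>u v w. 0 \<le> u \<and> 0 \<le> v \<and> 0 \<le> w \<and> u + v + w = 1 \<and>
      z = u *\<^sub>R (0, 0) + v *\<^sub>R (2, 0) + w *\<^sub>R (0, 1)"
    by (intro exI[of _ "1 - x / 2 - y"] exI[of _ "x / 2"] exI[of _ y]) simp
  then show "z \<in> prototile"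
    unfolding prototile_def convex_hull_3 by blast
qed

lemma interior_prototile: "interior prototile = {(x, y). 0 < x \<and> 0 < y \<and> x + 2 * y < 2}"
proof -
  have eq: "prototile = {z. (1, 0) \<bullet> z \<ge> 0} \<inter> {z. (0, 1) \<bullet> z \<ge> 0} \<inter> {z. (1, 2) \<bullet> z \<le> 2}"
    unfolding prototile_eq by auto
  have "(1, 0) \<noteq> (0 :: plane)" "(0, 1) \<noteq> (0 :: plane)" "(1, 2) \<noteq> (0 :: plane)"
    by (simp_all add: zero_prod_def)
  note halfspaces = interior_halfspace_ge[OF this(1)] interior_halfspace_ge[OF this(2)]
    interior_halfspace_le[OF this(3)]
  have "interior prototile = {z. (1, 0) \<bullet> z > 0} \<inter> {z. (0, 1) \<bullet> z > 0} \<inter> {z. (1, 2) \<bullet> z < 2}"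
    unfolding eq interior_Int halfspaces ..
  then show ?thesis
    by (simp add: set_eq_iff)
qed

lemma plane_dist_square: "(a - c)\<^sup>2 + (b - d)\<^sup>2 = (dist (a, b) (c, d :: real))\<^sup>2" for a :: real
  by (simp add: dist_Pair_Pair dist_real_def)

text \<open>The coordinates of two points differ by at most 2 and at most 1, and the squares of
  these differences can add up to 5 only if both bounds are attained.\<close>

lemma prototile_far_points:
  assumes "z \<in> prototile" "w \<in> prototile" "dist z w = sqrt 5"
  shows "z = (2, 0) \<and> w = (0, 1) \<or> z = (0, 1) \<and> w = (2, 0)"
proof -
  obtain a b c d where [simp]: "z = (a, b)" "w = (c, d)" by (cases z, cases w)
  have bnd: "0 \<le> a" "0 \<le> b" "a + 2 * b \<le> 2" "0 \<le> c" "0 \<le> d" "c + 2 * d \<le> 2"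
    using assms by (auto simp: prototile_eq)
  have eq: "(a - c)\<^sup>2 + (b - d)\<^sup>2 = 5"
    using assms(3) by (simp add: plane_dist_square)
  have "\<bar>a - c\<bar> \<le> 2" "\<bar>b - d\<bar> \<le> 1" using bnd by linarith+
  then have sq: "(a - c)\<^sup>2 \<le> 2\<^sup>2" "(b - d)\<^sup>2 \<le> 1\<^sup>2"
    by (metis abs_le_square_iff abs_numeral abs_one)+
  then have "(a - c)\<^sup>2 = 2\<^sup>2" "(b - d)\<^sup>2 = 1\<^sup>2" using eq by simp_all
  then have "a - c = 2 \<or> a - c = -2" "b - d = 1 \<or> b - d = -1"
    by (metis power2_eq_iff)+
  then show ?thesis using bnd by auto
qed

text \<open>The ends of the hypotenuse are the only points at distance \<open>sqrt 5\<close>, so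
  they are fixed or swapped. Either case leaves two candidates for the image of the right-angle
  vertex, mirror images in the hypotenuse: (0, 0) and (4/5, 8/5), or (2, 1) and (6/5, -3/5). Only
  (0, 0) lies in the triangle.\<close>

lemma prototile_rigid:
  assumes g: "plane_isometry g" and sub: "g ` prototile \<subseteq> prototile"
  shows "g = id"
proof -
  have in_K: "g z \<in> prototile" if "z \<in> prototile" for z using sub that by auto
  have vert: "(0, 0) \<in> prototile" "(2, 0) \<in> prototile" "(0, 1) \<in> prototile"
    by (auto simp: prototile_eq)
  have d: "dist (g z) (g w) = dist z w" for z w using g unfolding plane_isometry_def by blast
  obtain p q where pq: "g (0, 0) = (p, q)" by fastforce
  have pqK: "0 \<le> p" "0 \<le> q" "p + 2 * q \<le> 2" using in_K[OF vert(1)] pq by (auto simp: prototile_eq)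
  have "dist (g (2, 0)) (g (0, 1)) = sqrt 5"
    unfolding d by (simp add: dist_Pair_Pair dist_real_def)
  from prototile_far_points[OF in_K[OF vert(2)] in_K[OF vert(3)] this]
  show ?thesis
  proof
    assume A: "g (2, 0) = (2, 0) \<and> g (0, 1) = (0, 1)"
    have "(p - 2)\<^sup>2 + (q - 0)\<^sup>2 = 2\<^sup>2" "(p - 0)\<^sup>2 + (q - 1)\<^sup>2 = 1\<^sup>2"
      using d[of "(0, 0)" "(2, 0)"] d[of "(0, 0)" "(0, 1)"] A pq
      unfolding plane_dist_square by (simp_all add: dist_Pair_Pair dist_real_def)
    then have "q = 2 * p" "p * p + q * q = 4 * p"
      by (simp_all add: power2_eq_square algebra_simps)
    moreover from this have "p * (5 * p - 4) = 0" by (simp add: algebra_simps)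
    then have "p = 0 \<or> p = 4 / 5" by auto
    ultimately have "p = 0 \<and> q = 0" using pqK by auto
    then show ?thesis using A pq plane_isometry_fixing_triangle[OF g] by simp
  next
    assume A: "g (2, 0) = (0, 1) \<and> g (0, 1) = (2, 0)"
    have sq: "(p - 0)\<^sup>2 + (q - 1)\<^sup>2 = 2\<^sup>2" "(p - 2)\<^sup>2 + (q - 0)\<^sup>2 = 1\<^sup>2"
      using d[of "(0, 0)" "(2, 0)"] d[of "(0, 0)" "(0, 1)"] A pq
      unfolding plane_dist_square by (simp_all add: dist_Pair_Pair dist_real_def)
    then have "4 * p - 2 * q = 6"
      by (simp add: power2_eq_square algebra_simps)
    then have q: "q = 2 * p - 3" by linarith
    then have "(5 * p - 6) * (p - 2) = 0"
      using sq(2) unfolding q power2_eq_square by (simp add: algebra_simps)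
    then have "p = 6 / 5 \<or> p = 2" by auto
    then show ?thesis using q pqK by auto
  qed
qed

text \<open>A tile, though only a point set, thus determines its isometry. This lets relative poses
  be compared between different patches.\<close>

lemma prototile_image_inject:
  assumes "plane_isometry g" "plane_isometry h" "g ` prototile = h ` prototile"
  shows "g = h"
proof -
  have h: "bij h" using assms(2) by (rule plane_isometry_bij)
  have "(inv h \<circ> g) ` prototile = prototile"
    unfolding image_comp [symmetric] assms(3) using h by (simp add: bij_is_inj image_inv_f_f)
  then have "inv h \<circ> g = id"
    using assms by (intro prototile_rigid plane_isometry_comp plane_isometry_inv) auto
  then show ?thesis
    using h by (intro ext) (metis bij_is_surj comp_apply id_apply surj_f_inv_f)
qed

section \<open>Integer poses\<close>

text \<open>The pose \<open>(a, b, c, d)\<close> stands for the map \<open>z \<mapsto> (a + b i) + (c + d i) z\<close> of the complex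
  plane, where \<open>c + d i\<close> is one of the four units.\<close>

type_synonym pose = "int \<times> int \<times> int \<times> int"

fun place :: "pose \<Rightarrow> plane \<Rightarrow> plane" where
  "place (a, b, c, d) (x, y) = (a + c * x - d * y, b + d * x + c * y)"

fun comp_pose :: "pose \<Rightarrow> pose \<Rightarrow> pose" where
  "comp_pose (a, b, c, d) (a', b', c', d') =
    (a + c * a' - d * b', b + d * a' + c * b', c * c' - d * d', d * c' + c * d')"

fun inv_pose :: "pose \<Rightarrow> pose" where
  "inv_pose (a, b, c, d) = (- (c * a + d * b), d * a - c * b, c, - d)"

definition units :: "(int \<times> int) set" where
  "units = {(1, 0), (- 1, 0), (0, 1), (0, - 1)}"

definition poses :: "pose set" where
  "poses = {(a, b, u). u \<in> units}"

abbreviation pose_tile :: "pose \<Rightarrow> plane set" where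
  "pose_tile p \<equiv> place p ` prototile"

lemma place_comp: "place (comp_pose p q) z = place p (place q z)"
  by (cases p; cases q; cases z) (simp add: algebra_simps)

lemma comp_poses: "p \<in> poses \<Longrightarrow> q \<in> poses \<Longrightarrow> comp_pose p q \<in> poses"
  by (cases p; cases q) (auto simp: poses_def units_def)

lemma inv_poses: "p \<in> poses \<Longrightarrow> inv_pose p \<in> poses"
  by (cases p) (auto simp: poses_def units_def)

lemma place_inv_left: "p \<in> poses \<Longrightarrow> place (inv_pose p) (place p z) = z"
  by (cases p; cases z) (auto simp: poses_def units_def)

lemma comp_inv_pose_right: "p \<in> poses \<Longrightarrow> comp_pose p (comp_pose (inv_pose p) q) = q"
  by (cases p; cases q) (auto simp: poses_def units_def)

lemma comp_inv_pose_left: "p \<in> poses \<Longrightarrow> comp_pose (inv_pose p) (comp_pose p q) = q"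
  by (cases p; cases q) (auto simp: poses_def units_def)

lemma comp_pose_assoc: "comp_pose (comp_pose p q) r = comp_pose p (comp_pose q r)"
  by (cases p; cases q; cases r) (simp add: algebra_simps)

lemma plane_isometry_place:
  assumes "p \<in> poses"
  shows "plane_isometry (place p)"
  unfolding plane_isometry_def
proof (intro allI)
  fix z w :: plane
  obtain a b c d where p: "p = (a, b, c, d)" by (cases p)
  obtain x y x' y' where z: "z = (x, y)" "w = (x', y')" by fastforce
  have "(place p z, place p w) = ((a + c * x - d * y, b + d * x + c * y), (a + c * x' - d * y', b + d * x' + c * y'))"
    by (simp add: p z)
  moreover have "(dist (a + c * x - d * y, b + d * x + c * y) (a + c * x' - d * y', b + d * x' + c * y'))\<^sup>2
    = (dist z w)\<^sup>2"
    using assms unfolding z plane_dist_square [symmetric]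
    by (auto simp: p poses_def units_def power2_eq_square algebra_simps)
  ultimately show "dist (place p z) (place p w) = dist z w" by simp
qed

section \<open>The substitution in terms of poses\<close>

text \<open>This is \<open>sqrt 5\<close> times a reflection, and it takes the prototile to \<open>expanded_tile\<close>.\<close>

fun expand :: "plane \<Rightarrow> plane" where
  "expand (x, y) = (x + 2 * y, 2 * x - y)"

text \<open>In complex terms \<open>expand\<close> is multiplication by 1 + 2i after conjugation.
  Moving it past \<open>place p\<close> therefore expands the translation and conjugates the
  unit.\<close>

fun twist :: "pose \<Rightarrow> pose" where
  "twist (a, b, c, d) = (a + 2 * b, 2 * a - b, c, - d)"

text \<open>The five triangles in the order of \<open>expanded_tile_dissection\<close>. The first
  two entries are the right-angle vertex, the last two the direction of the long leg.\<close>

definition children :: "pose set" where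
  "children = {(2, 0, - 1, 0), (1, 0, 0, 1), (2, 0, 0, 1), (1, 2, 0, - 1), (2, 2, 0, 1)}"

fun patch :: "nat \<Rightarrow> pose set" where
  "patch 0 = {(0, 0, 1, 0)}"
| "patch (Suc n) = {comp_pose (twist p) d | p d. p \<in> patch n \<and> d \<in> children}"

lemma patch_SucI: "p \<in> patch n \<Longrightarrow> d \<in> children \<Longrightarrow> comp_pose (twist p) d \<in> patch (Suc n)"
  unfolding patch.simps by blast

lemma patch_SucE:
  assumes "q \<in> patch (Suc n)"
  obtains p d where "p \<in> patch n" "d \<in> children" "q = comp_pose (twist p) d"
  using assms unfolding patch.simps by blast

lemma twist_poses: "p \<in> poses \<Longrightarrow> twist p \<in> poses"
  by (cases p) (auto simp: poses_def units_def)

lemma children_poses: "d \<in> children \<Longrightarrow> d \<in> poses"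
  by (auto simp: children_def poses_def units_def)

lemma patch_poses: "p \<in> patch n \<Longrightarrow> p \<in> poses"
proof (induction n arbitrary: p)
  case 0
  then show ?case by (simp add: poses_def units_def)
next
  case (Suc n)
  then obtain q d where "q \<in> patch n" "d \<in> children" "p = comp_pose (twist q) d"
    using patch_SucE by metis
  then show ?case using Suc.IH comp_poses twist_poses children_poses by blast
qed

lemma expand_place: "expand (place p z) = place (twist p) (expand z)"
  by (cases p; cases z) (simp add: algebra_simps)

lemma linear_expand: "linear expand"
  by (rule linearI) (auto simp: algebra_simps)

lemma expand_expand: "expand (expand z) = 5 *\<^sub>R z"
  by (cases z) simp

lemma bij_expand: "bij expand"
proof (rule bijI)
  show "inj expand"
    by (rule inj_on_inverseI[of _ "\<lambda>z. expand z /\<^sub>R 5"]) (simp add: expand_expand)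
  show "surj expand"
    by (rule surjI[of _ "\<lambda>z. expand z /\<^sub>R 5"])
      (simp add: linear_cmul[OF linear_expand] expand_expand)
qed

lemma dist_expand: "dist (expand z) (expand w) = sqrt 5 * dist z w"
proof -
  obtain x y x' y' where z: "z = (x, y)" "w = (x', y')" by fastforce
  have "(x + 2 * y - (x' + 2 * y'))\<^sup>2 + (2 * x - y - (2 * x' - y'))\<^sup>2 = 5 * ((x - x')\<^sup>2 + (y - y')\<^sup>2)"
    by (simp add: power2_eq_square algebra_simps)
  then have "(dist (expand z) (expand w))\<^sup>2 = (sqrt 5 * dist z w)\<^sup>2"
    by (simp add: z plane_dist_square power_mult_distrib)
  then show ?thesis by simp
qed

lemma interior_expand_image: "interior (expand ` S) = expand ` interior S"
  by (simp add: interior_injective_linear_image linear_expand bij_expand bij_is_inj)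

lemma expanded_tile_eq: "expanded_tile = expand ` prototile"
  unfolding prototile_def expanded_tile_def convex_hull_linear_image[OF linear_expand]
  by (rule arg_cong[of _ _ "(hull) convex"]) auto

lemma expanded_tile_dissection_eq: "expanded_tile_dissection = pose_tile ` children"
proof -
  have "pose_tile d = convex hull {place d (0, 0), place d (2, 0), place d (0, 1)}" if "d \<in> poses" for d
    using plane_isometry_convex_hull[OF plane_isometry_place[OF that]]
    by (simp only: prototile_def image_insert image_empty)
  then have "pose_tile ` children = (\<lambda>d. convex hull {place d (0, 0), place d (2, 0), place d (0, 1)}) ` children"
    using children_poses by (intro image_cong refl) blast
  then show ?thesis
    by (simp add: expanded_tile_dissection_def children_def insert_commute)
qed

lemma dist_scaleR_both: "dist (r *\<^sub>R x) (r *\<^sub>R y) = \<bar>r\<bar> * dist x (y :: 'a :: real_normed_vector)"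
  by (simp add: dist_norm flip: scaleR_diff_right)

lemma expanded_tile_image_inject:
  assumes g: "plane_isometry g" and h: "plane_isometry h"
    and eq: "g ` expanded_tile = h ` expanded_tile"
  shows "g = h"
proof -
  \<comment> \<open>The factor \<open>sqrt 5\<close> of \<open>expand\<close> cancels, so
    \<open>conj f\<close> is an isometry again and the claim reduces to the prototile.\<close>
  define conj where "conj f z = f (expand z) /\<^sub>R sqrt 5" for f :: "plane \<Rightarrow> plane" and z
  have isom: "plane_isometry (conj f)" if "plane_isometry f" for f
    using that by (simp add: plane_isometry_def conj_def dist_expand dist_scaleR_both del: split_paired_All)
  have img: "conj f ` prototile = (\<lambda>z. z /\<^sub>R sqrt 5) ` f ` expanded_tile" for f
    by (simp add: conj_def expanded_tile_eq image_image)
  have "conj g = conj h"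
    using isom[OF g] isom[OF h] by (rule prototile_image_inject) (simp add: img eq)
  then have "g (expand z) = h (expand z)" for z
    by (auto simp: conj_def dest: fun_cong[of _ _ z])
  then show ?thesis
    using bij_expand by (metis bij_pointE ext)
qed

text \<open>The point is that \<open>h\<close> depends on \<open>g\<close> alone and not on
  \<open>p\<close>: one isometry serves all tiles of a patch at once.\<close>

lemma pinwheel_subst_tile_pose:
  assumes g: "plane_isometry g"
  obtains h where "plane_isometry h"
    "\<And>p t. p \<in> poses \<Longrightarrow> t \<in> pinwheel_subst_tile (g ` pose_tile p) \<Longrightarrow>
      \<exists>d\<in>children. t = h ` pose_tile (comp_pose (twist p) d)"
proof -
  \<comment> \<open>The inverse of \<open>expand\<close> is \<open>expand\<close> divided by 5, so
    this is the scaling after \<open>g\<close> after that inverse.\<close>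
  define h where "h z = sqrt 5 *\<^sub>R g (expand z /\<^sub>R 5)" for z
  have h: "plane_isometry h"
    using g by (simp add: plane_isometry_def h_def dist_expand dist_scaleR_both del: split_paired_All)
  have h_expand: "h (expand z) = sqrt 5 *\<^sub>R g z" for z
    by (simp add: h_def expand_expand)
  have "\<exists>d\<in>children. t = h ` pose_tile (comp_pose (twist p) d)"
    if p: "p \<in> poses" and t: "t \<in> pinwheel_subst_tile (g ` pose_tile p)" for p t
  proof -
    obtain k s where k: "plane_isometry k" "k ` expanded_tile = (*\<^sub>R) (sqrt 5) ` g ` pose_tile p"
      and s: "s \<in> expanded_tile_dissection" "t = k ` s"
      using t unfolding pinwheel_subst_tile_def by auto
    have "k ` expanded_tile = (h \<circ> place (twist p)) ` expanded_tile"
      unfolding k(2) by (simp add: expanded_tile_eq image_image expand_place [symmetric] h_expand)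
    then have "k = h \<circ> place (twist p)"
      using k(1) h p by (intro expanded_tile_image_inject plane_isometry_comp plane_isometry_place twist_poses)
    moreover obtain d where "d \<in> children" "s = pose_tile d"
      using s(1) unfolding expanded_tile_dissection_eq by auto
    ultimately show ?thesis
      using s(2) by (intro bexI[of _ d]) (simp_all add: image_image place_comp)
  qed
  then show thesis using that h by blast
qed

lemma supertile_patch:
  obtains g where "plane_isometry g" "supertile n \<subseteq> (\<lambda>p. g ` pose_tile p) ` patch n"
proof (induction n arbitrary: thesis)
  case 0
  have "place (0, 0, 1, 0) = id" by auto
  then show ?case by (intro 0[of id]) (simp_all add: supertile_def plane_isometry_def)
next
  case (Suc n)
  obtain g where g: "plane_isometry g" "supertile n \<subseteq> (\<lambda>p. g ` pose_tile p) ` patch n"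
    using Suc.IH by blast
  obtain h where h: "plane_isometry h"
    "\<And>p t. p \<in> poses \<Longrightarrow> t \<in> pinwheel_subst_tile (g ` pose_tile p) \<Longrightarrow>
      \<exists>d\<in>children. t = h ` pose_tile (comp_pose (twist p) d)"
    using pinwheel_subst_tile_pose[OF g(1)] by blast
  have "t \<in> (\<lambda>p. h ` pose_tile p) ` patch (Suc n)" if t: "t \<in> supertile (Suc n)" for t
  proof -
    obtain s where s: "s \<in> supertile n" "t \<in> pinwheel_subst_tile s"
      using t by (auto simp: supertile_def pinwheel_subst_def)
    then obtain p where "p \<in> patch n" "s = g ` pose_tile p" using g(2) by auto
    then obtain d where "d \<in> children" "t = h ` pose_tile (comp_pose (twist p) d)"
      using h(2) s(2) patch_poses by blast
    then show ?thesis using \<open>p \<in> patch n\<close> patch_SucI by blast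
  qed
  then show ?case by (intro Suc.prems[OF h(1)] subsetI)
qed

section \<open>Poses of adjacent tiles\<close>

lemma mem_pose_image:
  assumes "p \<in> poses"
  shows "z \<in> place p ` S \<longleftrightarrow> place (inv_pose p) z \<in> S"
proof -
  have "place p (place (inv_pose p) z) = z"
    using assms by (cases p; cases z) (auto simp: poses_def units_def)
  then show ?thesis
    using place_inv_left[OF assms] by (metis image_iff)
qed

lemma interior_pose_tile: "p \<in> poses \<Longrightarrow> interior (pose_tile p) = place p ` interior prototile"
  by (rule plane_isometry_interior_image[OF plane_isometry_place])

text \<open>Three of these tiles lie across the short leg, five across the long leg, and
  \<open>(2, 1, - 1, 0)\<close> lies across the hypotenuse. The unit (1, 0) does not occur, since
  two tiles of equal direction never have opposite outer normals.\<close>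

definition neighbours :: "pose set" where
  "neighbours = {(0, 1, - 1, 0), (1, 0, - 1, 0), (2, 0, - 1, 0), (2, 1, - 1, 0), (3, 0, - 1, 0),
    (0, - 1, 0, 1), (0, 0, 0, 1), (0, 0, 0, - 1), (1, 0, 0, - 1)}"

text \<open>Here and in the next three lemmas the two points lie in the prototile and in a second
  tile with right-angle vertex (a, b). The fractions are the coordinates of sample points interior
  to the prototile, chosen so that every overlapping integer position has one of them in the
  interior of the second tile. Outside \<open>neighbours\<close>, each remaining position in the
  bounding box meets the prototile in at most one point.\<close>

lemma two_points_unit_1:
  fixes a b :: int and x y x' y' :: real
  assumes "0 \<le> x" "0 \<le> y" "x + 2 * y \<le> 2" "0 \<le> x'" "0 \<le> y'" "x' + 2 * y' \<le> 2"
    and "a \<le> x" "b \<le> y" "(x - a) + 2 * (y - b) \<le> 2" "a \<le> x'" "b \<le> y'" "(x' - a) + 2 * (y' - b) \<le> 2"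
    and "\<not> (a < (1/4 :: real) \<and> b < (1/3 :: real) \<and> (1/4 - a) + 2 * (1/3 - b) < (2 :: real))"
    and "\<not> (a < (5/4 :: real) \<and> b < (1/3 :: real) \<and> (5/4 - a) + 2 * (1/3 - b) < (2 :: real))"
  shows "x = x' \<and> y = y'"
proof -
  have "real_of_int (- 2) \<le> a" "a \<le> real_of_int 2" "real_of_int (- 1) \<le> b" "b \<le> real_of_int 1"
    using assms(1-9) by simp_all
  then have "- 2 \<le> a" "a \<le> 2" "- 1 \<le> b" "b \<le> 1"
    unfolding of_int_le_iff .
  then have "a = - 2 \<or> a = - 1 \<or> a = 0 \<or> a = 1 \<or> a = 2" "b = - 1 \<or> b = 0 \<or> b = 1"
    by presburger+
  then show ?thesis
    using assms by (elim disjE; simp; intro conjI; linarith)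
qed

lemma two_points_unit_minus_1:
  fixes a b :: int and x y x' y' :: real
  assumes "0 \<le> x" "0 \<le> y" "x + 2 * y \<le> 2" "0 \<le> x'" "0 \<le> y'" "x' + 2 * y' \<le> 2"
    and "x \<le> a" "y \<le> b" "(a - x) + 2 * (b - y) \<le> 2" "x' \<le> a" "y' \<le> b" "(a - x') + 2 * (b - y') \<le> 2"
    and "\<not> ((1/2 :: real) < a \<and> (1/2 :: real) < b \<and> (a - 1/2) + 2 * (b - 1/2) < (2 :: real))"
    and "(a, b, - 1, 0) \<notin> neighbours"
  shows "x = x' \<and> y = y'"
proof -
  have "real_of_int (0) \<le> a" "a \<le> real_of_int 4" "real_of_int (0) \<le> b" "b \<le> real_of_int 2"
    using assms(1-9) by simp_all
  then have "0 \<le> a" "a \<le> 4" "0 \<le> b" "b \<le> 2"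
    unfolding of_int_le_iff .
  then have "a = 0 \<or> a = 1 \<or> a = 2 \<or> a = 3 \<or> a = 4" "b = 0 \<or> b = 1 \<or> b = 2"
    by presburger+
  then show ?thesis
    using assms by (elim disjE; simp add: neighbours_def; intro conjI; linarith)
qed

lemma two_points_unit_i:
  fixes a b :: int and x y x' y' :: real
  assumes "0 \<le> x" "0 \<le> y" "x + 2 * y \<le> 2" "0 \<le> x'" "0 \<le> y'" "x' + 2 * y' \<le> 2"
    and "x \<le> a" "b \<le> y" "(y - b) + 2 * (a - x) \<le> 2" "x' \<le> a" "b \<le> y'" "(y' - b) + 2 * (a - x') \<le> 2"
    and "\<not> ((2/3 :: real) < a \<and> b < (1/4 :: real) \<and> (1/4 - b) + 2 * (a - 2/3) < (2 :: real))"
    and "\<not> ((5/3 :: real) < a \<and> b < (1/12 :: real) \<and> (1/12 - b) + 2 * (a - 5/3) < (2 :: real))"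
    and "(a, b, 0, 1) \<notin> neighbours"
  shows "x = x' \<and> y = y'"
proof -
  have "real_of_int (0) \<le> a" "a \<le> real_of_int 3" "real_of_int (- 2) \<le> b" "b \<le> real_of_int 1"
    using assms(1-9) by simp_all
  then have "0 \<le> a" "a \<le> 3" "- 2 \<le> b" "b \<le> 1"
    unfolding of_int_le_iff .
  then have "a = 0 \<or> a = 1 \<or> a = 2 \<or> a = 3" "b = - 2 \<or> b = - 1 \<or> b = 0 \<or> b = 1"
    by presburger+
  then show ?thesis
    using assms by (elim disjE; simp add: neighbours_def; intro conjI; linarith)
qed

lemma two_points_unit_minus_i:
  fixes a b :: int and x y x' y' :: real
  assumes "0 \<le> x" "0 \<le> y" "x + 2 * y \<le> 2" "0 \<le> x'" "0 \<le> y'" "x' + 2 * y' \<le> 2"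
    and "a \<le> x" "y \<le> b" "(b - y) + 2 * (x - a) \<le> 2" "a \<le> x'" "y' \<le> b" "(b - y') + 2 * (x' - a) \<le> 2"
    and "\<not> (a < (1/4 :: real) \<and> (2/3 :: real) < b \<and> (b - 2/3) + 2 * (1/4 - a) < (2 :: real))"
    and "\<not> (a < (13/12 :: real) \<and> (1/3 :: real) < b \<and> (b - 1/3) + 2 * (13/12 - a) < (2 :: real))"
    and "(a, b, 0, - 1) \<notin> neighbours"
  shows "x = x' \<and> y = y'"
proof -
  have "real_of_int (- 1) \<le> a" "a \<le> real_of_int 2" "real_of_int (0) \<le> b" "b \<le> real_of_int 3"
    using assms(1-9) by simp_all
  then have "- 1 \<le> a" "a \<le> 2" "0 \<le> b" "b \<le> 3"
    unfolding of_int_le_iff .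
  then have "a = - 1 \<or> a = 0 \<or> a = 1 \<or> a = 2" "b = 0 \<or> b = 1 \<or> b = 2 \<or> b = 3"
    by presburger+
  then show ?thesis
    using assms by (elim disjE; simp add: neighbours_def; intro conjI; linarith)
qed

lemma neighbour_of_prototile:
  assumes r: "r \<in> poses" and disj: "interior prototile \<inter> interior (pose_tile r) = {}"
    and z: "z \<in> prototile" "z \<in> pose_tile r" and w: "w \<in> prototile" "w \<in> pose_tile r" and "z \<noteq> w"
  shows "r \<in> neighbours"
proof (rule ccontr)
  assume not: "r \<notin> neighbours"
  obtain x y x' y' where zw: "z = (x, y)" "w = (x', y')" by fastforce
  obtain a b u where ab: "r = (a, b, u)" and u: "u \<in> units" using r by (auto simp: poses_def)
  have K: "0 \<le> x" "0 \<le> y" "x + 2 * y \<le> 2" "0 \<le> x'" "0 \<le> y'" "x' + 2 * y' \<le> 2"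
    using z(1) w(1) by (simp_all add: prototile_eq zw)
  have rK: "place (inv_pose r) (x, y) \<in> prototile" "place (inv_pose r) (x', y') \<in> prototile"
    using z(2) w(2) by (simp_all add: mem_pose_image[OF r] zw)
  \<comment> \<open>Disjointness of interiors enters only through the sample points at which this is
    instantiated below.\<close>
  have out: "place (inv_pose r) v \<notin> interior prototile" if "v \<in> interior prototile" for v
    using that disj by (auto simp: interior_pose_tile[OF r] mem_pose_image[OF r, symmetric])
  note rK = rK[unfolded prototile_eq] and out = out[unfolded interior_prototile]
  have "x = x' \<and> y = y'"
  proof -
    consider "u = (1, 0)" | "u = (- 1, 0)" | "u = (0, 1)" | "u = (0, - 1)"
      using u by (auto simp: units_def)
    then show ?thesis
    proof cases
      case 1
      show ?thesis
        by (rule two_points_unit_1[OF K, of a b])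
          (use rK out[of "(1/4, 1/3)"] out[of "(5/4, 1/3)"] in \<open>simp_all add: ab 1\<close>)
    next
      case 2
      show ?thesis
        by (rule two_points_unit_minus_1[OF K, of a b])
          (use rK out[of "(1/2, 1/2)"] not in \<open>simp_all add: ab 2\<close>)
    next
      case 3
      show ?thesis
        by (rule two_points_unit_i[OF K, of a b])
          (use rK out[of "(2/3, 1/4)"] out[of "(5/3, 1/12)"] not in \<open>simp_all add: ab 3\<close>)
    next
      case 4
      show ?thesis
        by (rule two_points_unit_minus_i[OF K, of a b])
          (use rK out[of "(1/4, 2/3)"] out[of "(13/12, 1/3)"] not in \<open>simp_all add: ab 4\<close>)
    qed
  qed
  with \<open>z \<noteq> w\<close> show False by (simp add: zw)
qed

section \<open>Patches have no overlaps\<close>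

lemma pose_tile_comp: "pose_tile (comp_pose p q) = place p ` pose_tile q"
  by (simp add: image_image place_comp)

lemma interior_pose_tile_nonempty: "p \<in> poses \<Longrightarrow> interior (pose_tile p) \<noteq> {}"
proof -
  have "(1/2, 1/2) \<in> interior prototile" by (simp add: interior_prototile)
  then show "p \<in> poses \<Longrightarrow> ?thesis" by (auto simp: interior_pose_tile)
qed

lemma child_subset:
  assumes "d \<in> children"
  shows "pose_tile d \<subseteq> expand ` prototile"
proof
  fix v assume "v \<in> pose_tile d"
  then obtain x y where v: "v = place d (x, y)" and "(x, y) \<in> prototile" by auto
  then have "0 \<le> x" "0 \<le> y" "x + 2 * y \<le> 2" by (auto simp: prototile_eq)
  then have "expand v /\<^sub>R 5 \<in> prototile"
    using assms by (auto simp: v children_def prototile_eq)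
  moreover have "v = expand (expand v /\<^sub>R 5)"
    by (simp add: linear_cmul[OF linear_expand] expand_expand)
  ultimately show "v \<in> expand ` prototile" by blast
qed

lemma children_disjoint:
  assumes "d \<in> children" "e \<in> children" "d \<noteq> e"
  shows "interior (pose_tile d) \<inter> interior (pose_tile e) = {}"
proof (rule ccontr)
  assume "\<not> ?thesis"
  then have "place d ` interior prototile \<inter> place e ` interior prototile \<noteq> {}"
    using assms(1,2) by (simp add: interior_pose_tile children_poses)
  then obtain z w where "place d z = place e w" "z \<in> interior prototile" "w \<in> interior prototile"
    by blast
  moreover obtain x y x' y' where "z = (x, y)" "w = (x', y')" by fastforce
  ultimately have "place d (x, y) = place e (x', y')"
    "0 < x" "0 < y" "x + 2 * y < 2" "0 < x'" "0 < y'" "x' + 2 * y' < 2"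
    by (simp_all add: interior_prototile)
  then show False
    using assms unfolding children_def by (elim insertE emptyE) simp_all
qed

lemma descendant_subset:
  assumes "d \<in> children"
  shows "pose_tile (comp_pose (twist p) d) \<subseteq> expand ` pose_tile p"
proof -
  have "expand ` pose_tile p = place (twist p) ` expand ` prototile"
    by (simp add: image_image expand_place)
  then show ?thesis
    unfolding pose_tile_comp using child_subset[OF assms] by blast
qed

text \<open>Children of one parent are disjoint by the dissection; children of different parents are
  separated because their expanded parents are.\<close>

lemma patch_disjoint:
  "p \<in> patch n \<Longrightarrow> q \<in> patch n \<Longrightarrow> p \<noteq> q \<Longrightarrow> interior (pose_tile p) \<inter> interior (pose_tile q) = {}"
proof (induction n arbitrary: p q)
  case 0
  then show ?case by simp
next
  case (Suc n)
  obtain p' d where p: "p' \<in> patch n" "d \<in> children" "p = comp_pose (twist p') d"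
    using Suc.prems(1) by (rule patch_SucE)
  obtain q' e where q: "q' \<in> patch n" "e \<in> children" "q = comp_pose (twist q') e"
    using Suc.prems(2) by (rule patch_SucE)
  show ?case
  proof (cases "p' = q'")
    case True
    have "twist p' \<in> poses" using p(1) patch_poses twist_poses by blast
    note isom = plane_isometry_place[OF this]
    have "d \<noteq> e" using p(3) q(3) True Suc.prems(3) by blast
    have "interior (pose_tile p) \<inter> interior (pose_tile q)
        = place (twist p') ` (interior (pose_tile d) \<inter> interior (pose_tile e))"
      unfolding p(3) q(3) True[symmetric] pose_tile_comp plane_isometry_interior_image[OF isom]
      using plane_isometry_bij[OF isom] by (simp add: image_Int bij_is_inj)
    also have "\<dots> = {}"
      using children_disjoint[OF p(2) q(2) \<open>d \<noteq> e\<close>] by simp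
    finally show ?thesis .
  next
    case False
    have "interior (expand ` pose_tile p') \<inter> interior (expand ` pose_tile q')
        = expand ` (interior (pose_tile p') \<inter> interior (pose_tile q'))"
      unfolding interior_expand_image using bij_expand by (simp add: image_Int bij_is_inj)
    also have "\<dots> = {}" using Suc.IH p(1) q(1) False by simp
    finally show ?thesis
      unfolding p(3) q(3)
      using interior_mono[OF descendant_subset[OF p(2)]] interior_mono[OF descendant_subset[OF q(2)]]
      by blast
  qed
qed

text \<open>A pose by itself can have several parents: \<open>(2, 0, - 1, 0)\<close> is a child of
  \<open>(0, 0, 1, 0)\<close> and of \<open>(0, 1, 0, - 1)\<close>. In one patch, two parents would
  both contain the interior of the child after expansion.\<close>

lemma patch_parent_unique:
  assumes "p \<in> patch n" "q \<in> patch n" "d \<in> children" "e \<in> children"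
    and eq: "comp_pose (twist p) d = comp_pose (twist q) e"
  shows "p = q \<and> d = e"
proof -
  have poses: "p \<in> poses" "twist p \<in> poses" "comp_pose (twist p) d \<in> poses"
    using assms patch_poses twist_poses comp_poses children_poses by blast+
  have "p = q"
  proof (rule ccontr)
    assume "p \<noteq> q"
    then have "interior (expand ` pose_tile p) \<inter> interior (expand ` pose_tile q) = {}"
      unfolding interior_expand_image using bij_expand patch_disjoint[OF assms(1,2)]
      by (simp add: image_Int[symmetric] bij_is_inj)
    moreover have "interior (pose_tile (comp_pose (twist p) d)) \<subseteq> interior (expand ` pose_tile p)"
      using assms(3) by (intro interior_mono descendant_subset)
    moreover have "interior (pose_tile (comp_pose (twist p) d)) \<subseteq> interior (expand ` pose_tile q)"
      unfolding eq using assms(4) by (intro interior_mono descendant_subset)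
    ultimately show False
      using interior_pose_tile_nonempty[OF poses(3)] by blast
  qed
  moreover from this have "d = e"
    using eq comp_inv_pose_left[OF poses(2)] by metis
  ultimately show ?thesis ..
qed

lemma neighbour_if_touching:
  assumes "p \<in> poses" "q \<in> poses" "interior (pose_tile p) \<inter> interior (pose_tile q) = {}"
    and "z \<in> pose_tile p \<inter> pose_tile q" "w \<in> pose_tile p \<inter> pose_tile q" "z \<noteq> w"
  shows "comp_pose (inv_pose p) q \<in> neighbours"
proof -
  define r where "r = comp_pose (inv_pose p) q"
  have r: "r \<in> poses" "q = comp_pose p r"
    using assms(1,2) by (auto simp: r_def comp_poses inv_poses comp_inv_pose_right)
  note isom = plane_isometry_place[OF assms(1)]
  have inj: "inj (place p)" using plane_isometry_bij[OF isom] by (rule bij_is_inj)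
  have "place p ` (interior prototile \<inter> interior (pose_tile r)) = {}"
    using assms(3) unfolding r(2) pose_tile_comp plane_isometry_interior_image[OF isom]
    by (simp add: image_Int[OF inj])
  then have disj: "interior prototile \<inter> interior (pose_tile r) = {}" by simp
  obtain z' where z': "z = place p z'" "z' \<in> prototile" "z' \<in> pose_tile r"
    using assms(4) unfolding r(2) pose_tile_comp image_Int[OF inj, symmetric] by blast
  obtain w' where w': "w = place p w'" "w' \<in> prototile" "w' \<in> pose_tile r"
    using assms(5) unfolding r(2) pose_tile_comp image_Int[OF inj, symmetric] by blast
  have "z' \<noteq> w'" using assms(6) z'(1) w'(1) by auto
  from neighbour_of_prototile[OF r(1) disj z'(2,3) w'(2,3) this]
  show ?thesis unfolding r_def .
qed

section \<open>Three colours suffice\<close>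

fun direction :: "pose \<Rightarrow> int \<times> int" where
  "direction (a, b, u) = u"

text \<open>The colour of a tile depends only on which child of its parent it is and on its direction;
  the table was found by computer search.\<close>

definition child_colour :: "pose \<Rightarrow> int \<times> int \<Rightarrow> nat" where
  "child_colour d u =
    (if u = (- 1, 0) then 0
     else if u = (0, - 1) then 1
     else if u = (0, 1) then (if d = (2, 2, 0, 1) then 0 else 2)
     else (if d \<in> {(1, 0, 0, 1), (2, 0, 0, 1)} then 1 else 2))"

lemma child_colour_less: "child_colour d u < 3"
  by (simp add: child_colour_def)

text \<open>Here \<open>r\<close> is the relative pose of the two parents, with the identity pose
  covering siblings, and \<open>u\<close> is the direction of the first parent after
  \<open>twist\<close>. Translations do not change directions, so the four values of
  \<open>u\<close> represent all placements.\<close>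

lemma child_colour_table:
  "\<forall>r\<in>insert (0, 0, 1, 0) neighbours. \<forall>d\<in>children. \<forall>e\<in>children.
    comp_pose (inv_pose d) (comp_pose (twist r) e) \<in> neighbours \<longrightarrow>
    (\<forall>u\<in>units. child_colour d (direction (comp_pose (0, 0, u) d)) \<noteq>
      child_colour e (direction (comp_pose (0, 0, u) (comp_pose (twist r) e))))"
  by code_simp

lemma direction_comp: "direction (comp_pose (a, b, u) p) = direction (comp_pose (0, 0, u) p)"
  by (cases u; cases p) simp

lemma twist_comp: "twist (comp_pose p q) = comp_pose (twist p) (twist q)"
  by (cases p; cases q) (simp add: algebra_simps)

lemma inv_pose_comp: "comp_pose (inv_pose (comp_pose p q)) (comp_pose p r) = comp_pose (inv_pose q) r"
  if "p \<in> poses" "q \<in> poses"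
  using that by (cases p; cases q; cases r) (auto simp: poses_def units_def)

lemma child_colour_neq:
  assumes p: "p \<in> poses" and r: "r \<in> insert (0, 0, 1, 0) neighbours"
    and d: "d \<in> children" and e: "e \<in> children"
    and nb: "comp_pose (inv_pose (comp_pose (twist p) d)) (comp_pose (twist (comp_pose p r)) e) \<in> neighbours"
  shows "child_colour d (direction (comp_pose (twist p) d)) \<noteq>
    child_colour e (direction (comp_pose (twist (comp_pose p r)) e))"
proof -
  obtain a b u where tp: "twist p = (a, b, u)" and u: "u \<in> units"
    using twist_poses[OF p] unfolding poses_def by blast
  have "comp_pose (inv_pose d) (comp_pose (twist r) e) \<in> neighbours"
    using nb unfolding twist_comp comp_pose_assoc inv_pose_comp[OF twist_poses[OF p] children_poses[OF d]] .
  then show ?thesis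
    using child_colour_table r d e u
    unfolding twist_comp comp_pose_assoc tp direction_comp[of a b] by blast
qed

text \<open>For tiles with disjoint interiors this amounts to \<open>share_segment\<close>, but it
  passes through injective maps and to supersets without any topology.\<close>

definition touching :: "plane set \<Rightarrow> plane set \<Rightarrow> bool" where
  "touching s t \<longleftrightarrow> (\<exists>z\<in>s \<inter> t. \<exists>w\<in>s \<inter> t. z \<noteq> w)"

lemma patch_colouring:
  "\<exists>c :: pose \<Rightarrow> nat. (\<forall>p. c p < 3) \<and>
    (\<forall>p\<in>patch n. \<forall>q\<in>patch n. p \<noteq> q \<longrightarrow> touching (pose_tile p) (pose_tile q) \<longrightarrow> c p \<noteq> c q)"
proof (cases n)
  case 0
  show ?thesis by (intro exI[of _ "\<lambda>_. 0"]) (simp add: 0)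
next
  case (Suc m)
  \<comment> \<open>Parent and child number of \<open>q\<close>, well defined on the patch by
    \<open>patch_parent_unique\<close>.\<close>
  define parts where "parts q = (THE (p, d). p \<in> patch m \<and> d \<in> children \<and> q = comp_pose (twist p) d)" for q
  have parts: "parts (comp_pose (twist p) d) = (p, d)" if pd: "p \<in> patch m" "d \<in> children" for p d
    unfolding parts_def
  proof (rule the_equality)
    fix x
    assume x: "case x of (p', d') \<Rightarrow> p' \<in> patch m \<and> d' \<in> children \<and> comp_pose (twist p) d = comp_pose (twist p') d'"
    obtain p' d' where x': "x = (p', d')" by (rule prod.exhaust)
    show "x = (p, d)"
      using x patch_parent_unique[of p m p' d d'] pd unfolding x' prod.case by blast
  qed (use pd in simp)
  define c where "c q = child_colour (snd (parts q)) (direction q)" for q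
  have c: "c (comp_pose (twist p) d) = child_colour d (direction (comp_pose (twist p) d))"
    if "p \<in> patch m" "d \<in> children" for p d
    using parts[OF that] by (simp add: c_def)
  show ?thesis
  proof (intro exI[of _ c] conjI allI ballI impI)
    show "c p < 3" for p by (simp add: c_def child_colour_less)
    fix p q
    assume pq: "p \<in> patch n" "q \<in> patch n" "p \<noteq> q" and "touching (pose_tile p) (pose_tile q)"
    then obtain z w where zw: "z \<noteq> w" "z \<in> pose_tile p \<inter> pose_tile q" "w \<in> pose_tile p \<inter> pose_tile q"
      unfolding touching_def by blast
    obtain p' d where p: "p' \<in> patch m" "d \<in> children" "p = comp_pose (twist p') d"
      using pq(1) unfolding Suc by (rule patch_SucE)
    obtain q' e where q: "q' \<in> patch m" "e \<in> children" "q = comp_pose (twist q') e"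
      using pq(2) unfolding Suc by (rule patch_SucE)
    have poses: "p \<in> poses" "q \<in> poses" "p' \<in> poses" "q' \<in> poses"
      using pq p(1) q(1) patch_poses by blast+
    have nb: "comp_pose (inv_pose p) q \<in> neighbours"
      using neighbour_if_touching[OF poses(1,2) patch_disjoint[OF pq] zw(2,3,1)] .
    define r where "r = comp_pose (inv_pose p') q'"
    have q': "q' = comp_pose p' r" using comp_inv_pose_right[OF poses(3)] by (simp add: r_def)
    have "r \<in> insert (0, 0, 1, 0) neighbours"
    proof (cases "p' = q'")
      case True
      have "comp_pose (inv_pose p') p' = (0, 0, 1, 0)"
        using poses(3) by (cases p') (auto simp: poses_def units_def)
      then show ?thesis by (simp add: r_def True)
    next
      case False
      have inj: "inj expand" using bij_expand by (rule bij_is_inj)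
      \<comment> \<open>Tiles lie in their expanded parents, so two common points of the tiles pull
        back to two common points of the parents, which are therefore neighbours.\<close>
      have sub: "pose_tile p \<inter> pose_tile q \<subseteq> expand ` (pose_tile p' \<inter> pose_tile q')"
        unfolding image_Int[OF inj] p(3) q(3) using descendant_subset p(2) q(2) by blast
      obtain z' where z': "z = expand z'" "z' \<in> pose_tile p' \<inter> pose_tile q'" using sub zw(2) by blast
      obtain w' where w': "w = expand w'" "w' \<in> pose_tile p' \<inter> pose_tile q'" using sub zw(3) by blast
      have "z' \<noteq> w'" using zw(1) z'(1) w'(1) by auto
      from neighbour_if_touching[OF poses(3,4) patch_disjoint[OF p(1) q(1) False] z'(2) w'(2) this]
      show ?thesis unfolding r_def by (rule insertI2)
    qed
    from child_colour_neq[OF poses(3) this p(2) q(2)] nb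
    show "c p \<noteq> c q"
      unfolding p(3) q(3) c[OF p(1,2)] c[OF q(1,2)] q'[symmetric] .
  qed
qed

section \<open>From patches to the tiling\<close>

lemma pinwheel_is_tiling: "rational_pinwheel_tiling T \<Longrightarrow> is_tiling T"
  unfolding rational_pinwheel_tiling_def by (rule conjunct1)

lemma pinwheel_is_tile: "rational_pinwheel_tiling T \<Longrightarrow> t \<in> T \<Longrightarrow> is_tile t"
  using pinwheel_is_tiling unfolding is_tiling_def by blast

lemma pinwheel_finite_poses:
  assumes "rational_pinwheel_tiling T" "finite F" "F \<subseteq> T"
  shows "\<exists>n g. plane_isometry g \<and> (\<forall>t\<in>F. \<exists>p\<in>patch n. t = g ` pose_tile p)"
proof -
  obtain n g where g: "plane_isometry g" "F \<subseteq> (\<lambda>t. g ` t) ` supertile n"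
    using assms unfolding rational_pinwheel_tiling_def by meson
  obtain h where h: "plane_isometry h" "supertile n \<subseteq> (\<lambda>p. h ` pose_tile p) ` patch n"
    using supertile_patch[of n] by blast
  have "\<forall>t\<in>F. \<exists>p\<in>patch n. t = (g \<circ> h) ` pose_tile p"
  proof
    fix t assume "t \<in> F"
    then obtain s where s: "s \<in> supertile n" "t = g ` s" using g(2) by blast
    then obtain p where "p \<in> patch n" "s = h ` pose_tile p" using h(2) by blast
    then show "\<exists>p\<in>patch n. t = (g \<circ> h) ` pose_tile p"
      using s(2) by (intro bexI[of _ p]) (simp_all add: image_comp)
  qed
  with plane_isometry_comp[OF g(1) h(1)] show ?thesis
    by (intro exI conjI)
qed

section \<open>Topology of a single tile, and adjacency\<close>

lemma tile_convex_hull: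
  assumes "is_tile t"
  obtains S where "finite S" "t = convex hull S"
proof -
  obtain g where "plane_isometry g" "t = g ` prototile"
    using assms by (auto simp: is_tile_def)
  then have "t = convex hull (g ` {(0, 0), (2, 0), (0, 1)})"
    by (simp only: prototile_def plane_isometry_convex_hull)
  then show thesis by (rule that[rotated]) simp
qed

lemma closed_tile: "is_tile t \<Longrightarrow> closed t"
  by (elim tile_convex_hull) (simp add: compact_imp_closed finite_imp_compact_convex_hull)

lemma convex_tile: "is_tile t \<Longrightarrow> convex t"
  by (elim tile_convex_hull) simp

lemma interior_tile_nonempty:
  assumes "is_tile t"
  shows "interior t \<noteq> {}"
proof -
  obtain g where "plane_isometry g" "t = g ` prototile"
    using assms by (auto simp: is_tile_def)
  moreover have "(1/2, 1/2) \<in> interior prototile" by (simp add: interior_prototile)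
  ultimately show ?thesis by (auto simp: plane_isometry_interior_image)
qed

lemma closure_interior_tile: "is_tile t \<Longrightarrow> closure (interior t) = t"
  using convex_closure_interior[OF convex_tile interior_tile_nonempty, of t]
  by (simp add: closed_tile)

lemma share_segment_imp_touching:
  assumes "is_tile s" "is_tile t" "share_segment s t"
  shows "touching s t"
proof -
  obtain a b where "a \<noteq> b" "closed_segment a b \<subseteq> frontier s \<inter> frontier t"
    using assms(3) unfolding share_segment_def by blast
  moreover have "frontier s \<subseteq> s" "frontier t \<subseteq> t"
    using assms(1,2) by (simp_all add: closed_tile frontier_subset_closed)
  moreover have "a \<in> closed_segment a b" "b \<in> closed_segment a b" by simp_all
  ultimately show ?thesis unfolding touching_def by blast
qed

text \<open>Convexity yields the segment between the two points. It lies in both frontiers: each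
  tile is the closure of its interior, so the open interior of the other tile misses it.\<close>

lemma touching_imp_share_segment:
  assumes tiles: "is_tile s" "is_tile t" and disj: "interior s \<inter> interior t = {}" and "touching s t"
  shows "share_segment s t"
proof -
  obtain a b where ab: "a \<noteq> b" "a \<in> s \<inter> t" "b \<in> s \<inter> t"
    using assms(4) unfolding touching_def by blast
  have "convex (s \<inter> t)" using tiles by (intro convex_Int convex_tile)
  then have "closed_segment a b \<subseteq> s \<inter> t" using ab by (intro closed_segment_subset)
  moreover have "s \<inter> t \<subseteq> frontier s \<inter> frontier t"
  proof -
    have "interior s \<inter> t = {}" "interior t \<inter> s = {}"
      using open_Int_closure_eq_empty[of "interior s" "interior t"]
        open_Int_closure_eq_empty[of "interior t" "interior s"] disj
      by (simp_all add: closure_interior_tile tiles Int_commute)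
    then show ?thesis
      using tiles by (auto simp: frontier_def closed_tile)
  qed
  ultimately show ?thesis
    unfolding share_segment_def using ab(1) by blast
qed

lemma touching_image:
  assumes "inj g"
  shows "touching (g ` s) (g ` t) \<longleftrightarrow> touching s t"
  unfolding touching_def image_Int[OF assms, symmetric]
  by (simp add: inj_eq[OF assms] del: Int_iff split_paired_Ex)

text \<open>The de Bruijn-Erdos argument: colourings form a product of finite discrete spaces,
  compact by Tychonoff, and each constraint cuts out a closed set that depends on two
  coordinates.\<close>

lemma colouring_compactness:
  fixes k :: nat and R :: "'a \<Rightarrow> 'a \<Rightarrow> bool"
  assumes fin: "\<And>F. finite F \<Longrightarrow> F \<subseteq> T \<Longrightarrow>
    \<exists>c. c ` F \<subseteq> {..<k} \<and> (\<forall>s\<in>F. \<forall>t\<in>F. R s t \<longrightarrow> c s \<noteq> c t)"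
  shows "\<exists>c. c ` T \<subseteq> {..<k} \<and> (\<forall>s\<in>T. \<forall>t\<in>T. R s t \<longrightarrow> c s \<noteq> c t)"
proof -
  define X where "X = product_topology (\<lambda>_. discrete_topology {..<k}) T"
  define C where "C st = {c \<in> topspace X. c (fst st) \<noteq> c (snd st)}" for st :: "'a \<times> 'a"
  define E where "E = {(s, t). s \<in> T \<and> t \<in> T \<and> R s t}"
  have top: "topspace X = (\<Pi>\<^sub>E t\<in>T. {..<k})" by (simp add: X_def)
  have range: "c u < k" if "c \<in> topspace X" "u \<in> T" for c u
    using that by (auto simp: top)
  have "compact_space X"
    by (simp add: X_def compact_space_product_topology compact_space_discrete_topology)
  have closed: "closedin X (C st)" if st: "st \<in> E" for st
  proof -
    obtain s t where [simp]: "st = (s, t)" and T: "s \<in> T" "t \<in> T" using st by (auto simp: E_def)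
    have proj: "continuous_map X (discrete_topology {..<k}) (\<lambda>c. c u)" if "u \<in> T" for u
      unfolding X_def using that by (rule continuous_map_product_projection)
    have "openin X {c \<in> topspace X. c u = i}" if "u \<in> T" "i < k" for u i
      using openin_continuous_map_preimage[OF proj[OF that(1)], of "{i}"] that(2) by simp
    then have "openin X (\<Union>i<k. {c \<in> topspace X. c s = i} \<inter> {c \<in> topspace X. c t = i})"
      using T by (intro openin_Union) blast
    moreover have "C st = topspace X - (\<Union>i<k. {c \<in> topspace X. c s = i} \<inter> {c \<in> topspace X. c t = i})"
      using T by (auto simp: C_def range)
    ultimately show ?thesis by (simp add: closedin_diff)
  qed
  \<comment> \<open>Including \<open>topspace X\<close> in the family forces a point of the
    intersection to be a colouring in range even if there are no constraints.\<close>
  have "\<Inter>\<G> \<noteq> {}" if G: "finite \<G>" "\<G> \<subseteq> insert (topspace X) (C ` E)" for \<G>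
  proof -
    have "finite (\<G> - {topspace X})" "\<G> - {topspace X} \<subseteq> C ` E" using G by auto
    then obtain E' where E': "E' \<subseteq> E" "finite E'" "\<G> - {topspace X} = C ` E'"
      using finite_subset_image by metis
    define F where "F = fst ` E' \<union> snd ` E'"
    have F: "finite F" "F \<subseteq> T" using E' by (auto simp: F_def E_def)
    obtain c where c: "c ` F \<subseteq> {..<k}" "\<forall>s\<in>F. \<forall>t\<in>F. R s t \<longrightarrow> c s \<noteq> c t"
      using fin[OF F] by blast
    \<comment> \<open>Tiles outside \<open>F\<close> get the default colour 0. It is a legal colour
      because the hypothesis for a singleton gives \<open>0 < k\<close>.\<close>
    define f where "f = (\<lambda>t\<in>T. if t \<in> F then c t else 0)"
    have "0 < k" if "t \<in> T" for t
      using fin[of "{t}"] that by auto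
    then have f: "f \<in> topspace X" using c(1) by (auto simp: top f_def image_subset_iff)
    have "f \<in> C st" if st: "st \<in> E'" for st
    proof -
      have "fst st \<in> F" "snd st \<in> F" using st by (simp_all add: F_def)
      moreover have "R (fst st) (snd st)" using st E'(1) by (auto simp: E_def)
      ultimately show ?thesis using f F(2) c(2) by (auto simp: C_def f_def)
    qed
    then have "f \<in> \<Inter>\<G>" using f E'(3) by blast
    then show ?thesis by blast
  qed
  moreover have "closedin X U" if "U \<in> insert (topspace X) (C ` E)" for U
    using that closed by auto
  ultimately have "\<Inter>(insert (topspace X) (C ` E)) \<noteq> {}"
    using \<open>compact_space X\<close> unfolding compact_space_fip by meson
  then obtain c where c: "c \<in> topspace X" "\<And>st. st \<in> E \<Longrightarrow> c \<in> C st" by blast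
  have "c s \<noteq> c t" if "s \<in> T" "t \<in> T" "R s t" for s t
    using c(2)[of "(s, t)"] that by (simp add: C_def E_def)
  moreover have "c ` T \<subseteq> {..<k}" using c(1) by (auto simp: top)
  ultimately show ?thesis by blast
qed

lemma pinwheel_face_colourable:
  assumes T: "rational_pinwheel_tiling T"
  shows "face_colourable T 3"
proof -
  have tile: "is_tile t" if "t \<in> T" for t
    using T that by (rule pinwheel_is_tile)
  have "\<exists>c. c ` F \<subseteq> {..<3 :: nat} \<and> (\<forall>s\<in>F. \<forall>t\<in>F. s \<noteq> t \<and> share_segment s t \<longrightarrow> c s \<noteq> c t)"
    if F: "finite F" "F \<subseteq> T" for F
  proof -
    obtain n g where g: "plane_isometry g" and pose: "\<forall>t\<in>F. \<exists>p. p \<in> patch n \<and> t = g ` pose_tile p"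
      using pinwheel_finite_poses[OF T F] unfolding Bex_def by (elim exE conjE) (rule that)
    obtain P where "\<forall>t\<in>F. P t \<in> patch n \<and> t = g ` pose_tile (P t)"
      using bchoice[OF pose] ..
    note P = this[rule_format]
    obtain c :: "pose \<Rightarrow> nat" where c: "\<forall>p. c p < 3"
      "\<forall>p\<in>patch n. \<forall>q\<in>patch n. p \<noteq> q \<longrightarrow> touching (pose_tile p) (pose_tile q) \<longrightarrow> c p \<noteq> c q"
      using patch_colouring[of n] by blast
    note c = c[rule_format]
    have "c (P s) \<noteq> c (P t)" if st: "s \<in> F" "t \<in> F" "s \<noteq> t" "share_segment s t" for s t
    proof (rule c(2))
      show "P s \<in> patch n" "P t \<in> patch n" using P st(1,2) by blast+
      show "P s \<noteq> P t" using P[OF st(1)] P[OF st(2)] st(3) by metis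
      have "touching (g ` pose_tile (P s)) (g ` pose_tile (P t))"
        using share_segment_imp_touching[OF tile tile st(4)] P[OF st(1)] P[OF st(2)] st(1,2) F(2)
        by (metis subsetD)
      then show "touching (pose_tile (P s)) (pose_tile (P t))"
        using touching_image plane_isometry_bij[OF g] bij_is_inj by blast
    qed
    then show ?thesis
      by (intro exI[of _ "c \<circ> P"]) (auto simp: c(1))
  qed
  from colouring_compactness[of T 3 "\<lambda>s t. s \<noteq> t \<and> share_segment s t", OF this]
  show ?thesis
    unfolding face_colourable_def proper_face_colouring_def .
qed

section \<open>Two colours do not suffice\<close>

lemma norm_prototile: "z \<in> prototile \<Longrightarrow> norm z \<le> 2"
proof -
  assume "z \<in> prototile"
  obtain x y where z: "z = (x, y)" by fastforce
  have b: "0 \<le> x" "0 \<le> y" "x + 2 * y \<le> 2" using \<open>z \<in> prototile\<close> by (auto simp: prototile_eq z)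
  have "norm z \<le> norm x + norm y" unfolding z by (rule norm_Pair_le)
  then show "norm z \<le> 2" using b by simp
qed

lemma norm_expand: "norm (expand z) = sqrt 5 * norm z"
  using dist_expand[of z 0] linear_0[OF linear_expand] by simp

lemma patch_norm: "p \<in> patch n \<Longrightarrow> z \<in> pose_tile p \<Longrightarrow> norm z \<le> 2 * sqrt 5 ^ n"
proof (induction n arbitrary: p z)
  case 0
  then show ?case by (auto intro: norm_prototile)
next
  case (Suc n)
  obtain q d where q: "q \<in> patch n" "d \<in> children" "p = comp_pose (twist q) d"
    using Suc.prems(1) by (rule patch_SucE)
  obtain w where "z = expand w" "w \<in> pose_tile q"
    using Suc.prems(2) descendant_subset[OF q(2), of q] unfolding q(3) by blast
  then show ?case using Suc.IH[OF q(1), of w] by (simp add: norm_expand)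
qed

text \<open>Any tile lies in a common patch with \<open>t0\<close>. Rigidity identifies
  \<open>g\<close> with the placement of \<open>t0\<close> there, so the relative pose of the two
  tiles is integral whichever patch was used.\<close>

lemma pinwheel_integer_grid:
  assumes T: "rational_pinwheel_tiling T" and t0: "t0 \<in> T"
  shows "\<exists>g. plane_isometry g \<and> t0 = g ` prototile \<and> (\<forall>t\<in>T. \<exists>r\<in>poses. t = g ` pose_tile r)"
proof -
  have "is_tile t0" using T t0 by (rule pinwheel_is_tile)
  then obtain g where g: "plane_isometry g" "t0 = g ` prototile" by (auto simp: is_tile_def)
  have "\<exists>r\<in>poses. t = g ` pose_tile r" if t: "t \<in> T" for t
  proof -
    have "finite {t0, t}" "{t0, t} \<subseteq> T" using t0 t by simp_all
    from pinwheel_finite_poses[OF T this]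
    obtain n h where h: "plane_isometry h" and pose: "\<forall>s\<in>{t0, t}. \<exists>p\<in>patch n. s = h ` pose_tile p"
      by (elim exE conjE) (rule that)
    have "\<exists>q\<in>patch n. t0 = h ` pose_tile q" "\<exists>p\<in>patch n. t = h ` pose_tile p"
      using pose by (rule bspec, simp)+
    then obtain q p where qp: "q \<in> patch n" "p \<in> patch n" and q: "t0 = h ` pose_tile q" and p: "t = h ` pose_tile p"
      by (elim bexE) (rule that)
    note q = patch_poses[OF qp(1)] q and p = patch_poses[OF qp(2)] p
    have "g ` prototile = (h \<circ> place q) ` prototile"
      using g(2) q(2) by (simp add: image_comp)
    with g(1) have "g = h \<circ> place q"
      using plane_isometry_comp[OF h plane_isometry_place[OF q(1)]] by (intro prototile_image_inject)
    then have "g ` pose_tile (comp_pose (inv_pose q) p) = h ` pose_tile (comp_pose q (comp_pose (inv_pose q) p))"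
      unfolding pose_tile_comp[of q] by (simp add: image_comp)
    then have "t = g ` pose_tile (comp_pose (inv_pose q) p)"
      unfolding comp_inv_pose_right[OF q(1)] p(2) by (rule sym)
    then show ?thesis using q(1) p(1) comp_poses inv_poses by blast
  qed
  then show ?thesis using g by blast
qed

lemma finite_poses_meeting_cball: "finite {r \<in> poses. pose_tile r \<inter> cball 0 R \<noteq> {}}"
proof -
  \<comment> \<open>Points of the prototile have coordinates between 0 and 2, so a turned tile stays
    within 2 of its right-angle vertex in each coordinate.\<close>
  define N where "N = \<lceil>R\<rceil> + 2"
  have "r \<in> {- N..N} \<times> {- N..N} \<times> units" if r: "r \<in> poses" and meet: "pose_tile r \<inter> cball 0 R \<noteq> {}" for r
  proof -
    obtain a b c d where abcd: "r = (a, b, c, d)" and u: "(c, d) \<in> units" using r by (auto simp: poses_def)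
    obtain z where z: "z \<in> prototile" "norm (place r z) \<le> R" using meet by auto
    obtain x y where xy: "z = (x, y)" by fastforce
    have K: "0 \<le> x" "0 \<le> y" "x + 2 * y \<le> 2" using z(1) by (auto simp: prototile_eq xy)
    have "\<bar>a + c * x - d * y\<bar> \<le> R" "\<bar>b + d * x + c * y\<bar> \<le> R"
      using z(2) norm_fst_le[of "a + c * x - d * y" "b + d * x + c * y"]
        norm_snd_le[of "b + d * x + c * y" "a + c * x - d * y"]
      by (simp_all add: abcd xy)
    then have "\<bar>real_of_int a\<bar> \<le> R + 2" "\<bar>real_of_int b\<bar> \<le> R + 2"
      using u K by (auto simp: units_def)
    then have "\<bar>real_of_int a\<bar> \<le> real_of_int N" "\<bar>real_of_int b\<bar> \<le> real_of_int N"
      unfolding N_def of_int_add using le_of_int_ceiling[of R] by linarith+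
    then have "\<bar>a\<bar> \<le> N" "\<bar>b\<bar> \<le> N"
      by (simp_all only: of_int_abs[symmetric] of_int_le_iff)
    then show ?thesis using u by (auto simp: abcd)
  qed
  then have "{r \<in> poses. pose_tile r \<inter> cball 0 R \<noteq> {}} \<subseteq> {- N..N} \<times> {- N..N} \<times> units"
    by blast
  then show ?thesis by (rule finite_subset) (simp add: units_def)
qed

lemma pinwheel_locally_finite:
  assumes T: "rational_pinwheel_tiling T"
    and g: "plane_isometry g" "\<forall>t\<in>T. \<exists>r\<in>poses. t = g ` pose_tile r"
  shows "finite {t \<in> T. t \<inter> cball (g 0) R \<noteq> {}}"
proof (rule finite_subset)
  show "finite ((\<lambda>r. g ` pose_tile r) ` {r \<in> poses. pose_tile r \<inter> cball 0 R \<noteq> {}})"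
    by (intro finite_imageI finite_poses_meeting_cball)
  show "{t \<in> T. t \<inter> cball (g 0) R \<noteq> {}} \<subseteq> (\<lambda>r. g ` pose_tile r) ` {r \<in> poses. pose_tile r \<inter> cball 0 R \<noteq> {}}"
  proof
    fix t assume t: "t \<in> {t \<in> T. t \<inter> cball (g 0) R \<noteq> {}}"
    then obtain r where r: "r \<in> poses" "t = g ` pose_tile r" using g(2) by blast
    obtain z where z: "z \<in> pose_tile r" "g z \<in> cball (g 0) R" using t r(2) by blast
    have "dist 0 z \<le> R" using z(2) g(1) unfolding plane_isometry_def mem_cball by metis
    then have "z \<in> pose_tile r \<inter> cball 0 R" using z(1) by (simp only: Int_iff mem_cball)
    then show "t \<in> (\<lambda>r. g ` pose_tile r) ` {r \<in> poses. pose_tile r \<inter> cball 0 R \<noteq> {}}"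
      using r by blast
  qed
qed

text \<open>Enough of the tiling around one tile is contained in a patch so large that the tile has a
  second-level supertile in it; the tiles of this supertile all belong to the tiling.\<close>

lemma pinwheel_contains_patch_2:
  assumes T: "rational_pinwheel_tiling T"
  shows "\<exists>h. plane_isometry h \<and>
    (\<forall>d\<in>children. \<forall>e\<in>children. h ` pose_tile (comp_pose (twist d) e) \<in> T)"
proof -
  have cover: "\<Union>T = UNIV" using pinwheel_is_tiling[OF T] unfolding is_tiling_def by blast
  then obtain t0 where t0: "t0 \<in> T" by blast
  obtain g where g: "plane_isometry g" "t0 = g ` prototile" "\<forall>t\<in>T. \<exists>r\<in>poses. t = g ` pose_tile r"
    using pinwheel_integer_grid[OF T t0] by (elim exE conjE) (rule that)
  have dist_g: "dist (g z) (g w) = dist z w" for z w using g(1) unfolding plane_isometry_def by blast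
  \<comment> \<open>Expanding twice multiplies distances by 5, and points of the prototile have
    distance at most 4 by the norm bound 2. Hence a second-level supertile through
    \<open>g 0\<close> lies within distance 20 of it.\<close>
  define F where "F = {t \<in> T. t \<inter> cball (g 0) 20 \<noteq> {}}"
  have "finite F" unfolding F_def using T g(1,3) by (rule pinwheel_locally_finite)
  moreover have "F \<subseteq> T" by (auto simp: F_def)
  ultimately have "\<exists>n h. plane_isometry h \<and> (\<forall>t\<in>F. \<exists>p\<in>patch n. t = h ` pose_tile p)"
    using pinwheel_finite_poses[OF T] by simp
  then obtain n h where h: "plane_isometry h" and pose: "\<forall>t\<in>F. \<exists>p\<in>patch n. t = h ` pose_tile p"
    by (elim exE conjE) (rule that)
  have dist_h: "dist (h z) (h w) = dist z w" for z w using h unfolding plane_isometry_def by blast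
  have inj_h: "inj h" using plane_isometry_bij[OF h] by (rule bij_is_inj)
  have near: "\<exists>p\<in>patch n. \<exists>w\<in>pose_tile p. h ` pose_tile p \<in> T \<and> z = h w" if z: "dist (g 0) z \<le> 20" for z
  proof -
    obtain t where "t \<in> T" "z \<in> t" using cover by blast
    then have "t \<in> F" using z by (auto simp: F_def)
    from bspec[OF pose this] obtain p where "p \<in> patch n" "t = h ` pose_tile p"
      by (rule bexE)
    then show ?thesis using \<open>t \<in> T\<close> \<open>z \<in> t\<close> by (metis imageE)
  qed
  \<comment> \<open>A patch of level 0 or 1 lies within 6 of the origin, too small to cover two
    points at distance 40.\<close>
  have "2 \<le> n"
  proof (rule ccontr)
    assume "\<not> 2 \<le> n"
    then have "n = 0 \<or> n = 1" by auto
    moreover have "sqrt 5 \<le> 3" by (rule real_le_lsqrt) auto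
    ultimately have "2 * sqrt 5 ^ n \<le> 6" by auto
    then have bound: "norm w \<le> 6" if "p \<in> patch n" "w \<in> pose_tile p" for p w
      using patch_norm[OF that] by linarith
    have "dist (g 0) (g (20, 0)) \<le> 20" "dist (g 0) (g (- 20, 0)) \<le> 20"
      unfolding dist_g by (simp_all add: dist_norm norm_Pair)
    from this[THEN near] obtain v w where vw: "g (20, 0) = h v" "norm v \<le> 6" "g (- 20, 0) = h w" "norm w \<le> 6"
      using bound by blast
    have "dist v w = dist (20, 0) ((- 20, 0) :: plane)"
      using vw(1,3) dist_g dist_h by metis
    also have "\<dots> = 40" by (simp add: dist_norm norm_Pair)
    finally show False using vw(2,4) norm_triangle_ineq4[of v w] by (simp add: dist_norm)
  qed
  then obtain m where n: "n = Suc (Suc m)" by (metis add_2_eq_Suc le_Suc_ex)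
  obtain q y where q: "q \<in> patch n" and y: "y \<in> pose_tile q" "g 0 = h y"
    using near[of "g 0"] by (metis dist_self zero_le_numeral)
  obtain q1 d2 where q1: "q1 \<in> patch (Suc m)" "d2 \<in> children" "q = comp_pose (twist q1) d2"
    using q unfolding n by (rule patch_SucE)
  obtain q0 d1 where q0: "q0 \<in> patch m" "d1 \<in> children" "q1 = comp_pose (twist q0) d1"
    using q1(1) by (rule patch_SucE)
  have q0_pose: "q0 \<in> poses" using q0(1) by (rule patch_poses)
  have grandchild: "pose_tile (comp_pose (twist (comp_pose (twist q0) d)) e) \<subseteq> expand ` expand ` pose_tile q0"
    if "d \<in> children" "e \<in> children" for d e
    using descendant_subset[OF that(2)] image_mono[OF descendant_subset[OF that(1)]]
    by (rule subset_trans)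
  have diam: "dist v w \<le> 20" if vw: "v \<in> expand ` expand ` pose_tile q0" "w \<in> expand ` expand ` pose_tile q0" for v w
  proof -
    obtain v' w' where v': "v' \<in> prototile" "v = 5 *\<^sub>R place q0 v'" and w': "w' \<in> prototile" "w = 5 *\<^sub>R place q0 w'"
      using vw by (auto simp: expand_expand simp del: place.simps)
    have "dist v w = 5 * dist v' w'"
      using plane_isometry_place[OF q0_pose] v'(2) w'(2)
      by (simp add: dist_scaleR_both plane_isometry_def del: split_paired_All)
    also have "dist v' w' \<le> 4"
      using norm_triangle_ineq4[of v' w'] norm_prototile[OF v'(1)] norm_prototile[OF w'(1)]
      by (simp add: dist_norm)
    finally show ?thesis by simp
  qed
  have in_T: "h ` pose_tile (comp_pose (twist (comp_pose (twist q0) d)) e) \<in> T"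
    if de: "d \<in> children" "e \<in> children" for d e
  proof -
    define s where "s = comp_pose (twist (comp_pose (twist q0) d)) e"
    have s: "s \<in> patch n" unfolding s_def n using q0(1) de by (intro patch_SucI)
    \<comment> \<open>An interior point is chosen so that the tile of the tiling that covers it
      overlaps \<open>s\<close>. Both are tiles of the patch, hence equal.\<close>
    obtain x where x: "x \<in> interior (pose_tile s)"
      using interior_pose_tile_nonempty[OF patch_poses[OF s]] by blast
    have "dist y x \<le> 20"
    proof (rule diam)
      show "x \<in> expand ` expand ` pose_tile q0"
        using subsetD[OF grandchild[OF de]] subsetD[OF interior_subset x] unfolding s_def by simp
      show "y \<in> expand ` expand ` pose_tile q0"
        using subsetD[OF grandchild[OF q0(2) q1(2)]] y(1) unfolding q1(3) q0(3) by simp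
    qed
    then have "dist (g 0) (h x) \<le> 20" by (simp add: y(2) dist_h)
    from near[OF this] obtain p w where p: "p \<in> patch n" "w \<in> pose_tile p" "h ` pose_tile p \<in> T" "h x = h w"
      by blast
    have "is_tile (pose_tile p)"
      using plane_isometry_place[OF patch_poses[OF p(1)]] by (auto simp: is_tile_def)
    moreover have "x \<in> pose_tile p" using p(2,4) inj_h by (simp add: inj_eq)
    ultimately have "x \<in> closure (interior (pose_tile p))" by (simp only: closure_interior_tile)
    then have "interior (pose_tile s) \<inter> interior (pose_tile p) \<noteq> {}"
      using open_Int_closure_eq_empty[of "interior (pose_tile s)" "interior (pose_tile p)"] x by blast
    then have "s = p" using patch_disjoint[OF s p(1)] by blast
    then show ?thesis using p(3) unfolding s_def by simp
  qed
  show ?thesis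
  proof (intro exI[of _ "h \<circ> place (twist (twist q0))"] conjI ballI)
    show "plane_isometry (h \<circ> place (twist (twist q0)))"
      using h q0_pose by (intro plane_isometry_comp plane_isometry_place twist_poses)
    show "(h \<circ> place (twist (twist q0))) ` pose_tile (comp_pose (twist d) e) \<in> T"
      if "d \<in> children" "e \<in> children" for d e
      using in_T[OF that] unfolding twist_comp comp_pose_assoc pose_tile_comp image_comp[symmetric] .
  qed
qed

text \<open>The three tiles meet at (5, 2), the midpoint of the long leg of \<open>?r\<close> and
  the right-angle vertex of both \<open>?s\<close> and \<open>?t\<close>. The latter two are
  siblings that share part of a leg and each cover half of that long leg from the other side;
  \<open>?r\<close> has a different parent.\<close>

lemma pinwheel_three_touching_tiles:
  assumes T: "rational_pinwheel_tiling T"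
  obtains r s t where "{r, s, t} \<subseteq> T" "r \<noteq> s" "r \<noteq> t" "s \<noteq> t"
    "touching r s" "touching r t" "touching s t"
proof -
  obtain h where h: "plane_isometry h"
    and "\<forall>d\<in>children. \<forall>e\<in>children. h ` pose_tile (comp_pose (twist d) e) \<in> T"
    using pinwheel_contains_patch_2[OF T] by (elim exE conjE) (rule that)
  note in_T = this(2)[rule_format]
  have inj: "inj h" using plane_isometry_bij[OF h] by (rule bij_is_inj)
  let ?r = "(4, 2, 1, 0) :: pose" and ?s = "(5, 2, 0, - 1) :: pose" and ?t = "(5, 2, - 1, 0) :: pose"
  have poses: "?r \<in> poses" "?s \<in> poses" "?t \<in> poses" by (simp_all add: poses_def units_def)
  note mem = poses[THEN mem_pose_image]
  \<comment> \<open>The positive memberships give two common points for each pair; the negative ones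
    tell the tiles apart.\<close>
  have points: "(4, 2) \<in> pose_tile ?r" "(5, 2) \<in> pose_tile ?r" "(6, 2) \<in> pose_tile ?r"
    "(4, 2) \<notin> pose_tile ?s" "(5, 1) \<in> pose_tile ?s" "(5, 2) \<in> pose_tile ?s" "(6, 2) \<in> pose_tile ?s"
    "(4, 2) \<in> pose_tile ?t" "(5, 1) \<in> pose_tile ?t" "(5, 2) \<in> pose_tile ?t" "(6, 2) \<notin> pose_tile ?t"
    unfolding mem by (simp_all add: prototile_eq)
  have eqs: "?r = comp_pose (twist (2, 0, 0, 1)) (2, 2, 0, 1)"
    "?s = comp_pose (twist (1, 2, 0, - 1)) (2, 0, - 1, 0)"
    "?t = comp_pose (twist (1, 2, 0, - 1)) (2, 0, 0, 1)"
    by simp_all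
  show thesis
  proof (rule that)
    show "{h ` pose_tile ?r, h ` pose_tile ?s, h ` pose_tile ?t} \<subseteq> T"
      unfolding insert_subset eqs by (intro conjI in_T empty_subsetI) (simp_all add: children_def)
    show "h ` pose_tile ?r \<noteq> h ` pose_tile ?s" "h ` pose_tile ?r \<noteq> h ` pose_tile ?t"
      "h ` pose_tile ?s \<noteq> h ` pose_tile ?t"
      unfolding inj_image_eq_iff[OF inj] using points by metis+
    have neq: "(5, 2) \<noteq> (6 :: real, 2 :: real)" "(4, 2) \<noteq> (5 :: real, 2 :: real)" "(5, 1) \<noteq> (5 :: real, 2 :: real)"
      by simp_all
    show "touching (h ` pose_tile ?r) (h ` pose_tile ?s)" "touching (h ` pose_tile ?r) (h ` pose_tile ?t)"
      "touching (h ` pose_tile ?s) (h ` pose_tile ?t)"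
      unfolding touching_image[OF inj] unfolding touching_def using points neq by blast+
  qed
qed

lemma pinwheel_colours_ge_3:
  assumes T: "rational_pinwheel_tiling T" and m: "face_colourable T m"
  shows "3 \<le> m"
proof -
  obtain c :: "plane set \<Rightarrow> nat" where c: "c ` T \<subseteq> {..<m}" "proper_face_colouring T c"
    using m unfolding face_colourable_def by blast
  obtain r s t where rst: "{r, s, t} \<subseteq> T" "r \<noteq> s" "r \<noteq> t" "s \<noteq> t"
    and touch: "touching r s" "touching r t" "touching s t"
    using pinwheel_three_touching_tiles[OF T] by blast
  have disj: "pairwise (\<lambda>s t. interior s \<inter> interior t = {}) T"
    using pinwheel_is_tiling[OF T] unfolding is_tiling_def by (elim conjE)
  have "c u \<noteq> c v" if uv: "u \<in> T" "v \<in> T" "u \<noteq> v" "touching u v" for u v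
  proof -
    have "share_segment u v"
      using pinwheel_is_tile[OF T uv(1)] pinwheel_is_tile[OF T uv(2)] pairwiseD[OF disj uv(1-3)] uv(4)
      by (rule touching_imp_share_segment)
    then show ?thesis using c(2) uv(1-3) unfolding proper_face_colouring_def by simp
  qed
  then have "c r \<noteq> c s" "c r \<noteq> c t" "c s \<noteq> c t" using rst touch by auto
  then have "card {c r, c s, c t} = 3" by simp
  moreover have "{c r, c s, c t} \<subseteq> {..<m}" using c(1) rst(1) by auto
  then have "card {c r, c s, c t} \<le> m" using card_mono[of "{..<m}"] by fastforce
  ultimately show ?thesis by simp
qed

theorem theorem5p5:
  fixes T :: "plane set set"
  assumes "rational_pinwheel_tiling T"
  shows "min_face_colours T 3"
  unfolding min_face_colours_def
  using pinwheel_face_colourable[OF assms] pinwheel_colours_ge_3[OF assms] by (intro conjI allI impI)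

end
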